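(* Let $k\ge 2$ and $n\ge 1$ be integers. (i) If $F\subseteq\{0,\dots,k-1\}^n$ satisfies $(f_1,f_2)\equiv 0\pmod k$ for all $f_1,f_2\in F$ (including $f_1=f_2$), then $|F|\le k^{n/2}$. (ii) Suppose moreover that $k$ is prime, let $F\subseteq\{0,\dots,k-1\}^n$, and suppose that the number of ordered pairs $(f_1,f_2)\in F\times F$ with $(f_1,f_2)\not\equiv 0\pmod k$ is at most $\varepsilon|F|^2$, where $0\le\varepsilon<\frac{k-1}{k}$. Then \[ |F|\le\frac{k^{n/2}}{1-\frac{k}{k-1}\varepsilon}. \]
   Context: Here $(f_1,f_2)=\sum_{r=1}^n x_ry_r$ denotes the standard integer scalar product of $f_1=(x_1,\dots,x_n)$ and $f_2=(y_1,\dots,y_n)$. A family as in (i) is called a $k$-town family. *)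

theory Defs
  imports Complex_Main "HOL-Library.FuncSet" "HOL-Number_Theory.Cong"
    "HOL-Computational_Algebra.Primes"
begin

text \<open>Vectors of length \<open>n\<close> are extensional functions on \<open>{1..n}\<close>, so that distinct
  elements of \<open>cube k n\<close> are distinct vectors and \<open>card\<close> counts vectors.\<close>

definition cube :: "int \<Rightarrow> nat \<Rightarrow> (nat \<Rightarrow> int) set" where
  "cube k n = {1..n} \<rightarrow>\<^sub>E {0..k - 1}"

definition scalar_product :: "nat \<Rightarrow> (nat \<Rightarrow> int) \<Rightarrow> (nat \<Rightarrow> int) \<Rightarrow> int" where
  "scalar_product n f g = (\<Sum>r = 1..n. f r * g r)"

definition town_family :: "int \<Rightarrow> nat \<Rightarrow> (nat \<Rightarrow> int) set \<Rightarrow> bool" where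
  "town_family k n F \<longleftrightarrow>
     F \<subseteq> cube k n \<and> (\<forall>f\<in>F. \<forall>g\<in>F. [scalar_product n f g = 0] (mod k))"

end

theory Submission
  imports Defs "HOL-Library.Real_Mod" "HOL-Analysis.Convex"
begin

text \<open>Let \<open>e(m) = exp(2\<pi>im/k)\<close> and \<open>S\<^sub>t = \<Sum>f\<in>F. \<Sum>g\<in>F. e(t (f, g))\<close>. For \<open>t\<close> coprime to \<open>k\<close>,
  Cauchy-Schwarz in \<open>f\<close>, extension of the sum over \<open>f\<close> to the whole cube, and Parseval give
  \<open>|S\<^sub>t| \<le> |F| k\<^bsup>n/2\<^esup>\<close>. For a \<open>k\<close>-town family \<open>S\<^sub>1 = |F|\<^sup>2\<close>, which is (i). For prime \<open>k\<close>, if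
  \<open>N\<close> ordered pairs are not orthogonal, then by orthogonality of characters
  \<open>S\<^sub>1 + \<dots> + S\<^bsub>k-1\<^esub> = (k-1) |F|\<^sup>2 - k N\<close>, which is (ii).\<close>

definition add_char :: "int \<Rightarrow> int \<Rightarrow> complex" where
  "add_char k m = cis (2 * pi * of_int m / of_int k)"

definition char_sum :: "int \<Rightarrow> nat \<Rightarrow> (nat \<Rightarrow> int) set \<Rightarrow> int \<Rightarrow> complex" where
  "char_sum k n F t = (\<Sum>f\<in>F. \<Sum>g\<in>F. add_char k (t * scalar_product n f g))"

lemma add_char_0 [simp]: "add_char k 0 = 1"
  by (simp add: add_char_def)

lemma add_char_add: "add_char k (a + b) = add_char k a * add_char k b"
  by (simp add: add_char_def cis_mult ring_distribs add_divide_distrib)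

lemma cnj_add_char: "cnj (add_char k a) = add_char k (- a)"
  by (simp add: add_char_def cis_cnj)

lemma add_char_sum: "add_char k (sum f A) = (\<Prod>x\<in>A. add_char k (f x))"
  by (induction A rule: infinite_finite_induct) (simp_all add: add_char_add)

lemma add_char_power: "add_char k m ^ j = add_char k (int j * m)"
  by (simp add: add_char_def DeMoivre algebra_simps)

lemma add_char_eq_1_iff:
  assumes "k \<noteq> 0"
  shows "add_char k m = 1 \<longleftrightarrow> k dvd m"
proof -
  have "add_char k m = 1 \<longleftrightarrow> (\<exists>j::int. real_of_int m = real_of_int (k * j))"
    using assms by (simp add: add_char_def cis_eq_1_iff field_simps)
  also have "\<dots> \<longleftrightarrow> k dvd m"
    unfolding of_int_eq_iff by (auto simp: dvd_def)
  finally show ?thesis .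
qed

text \<open>This is a geometric sum with ratio \<open>add_char k m\<close>, a \<open>k\<close>-th
  root of unity: the ratio is 1 exactly when \<open>k dvd m\<close>, and otherwise the numerator
  ratio^k - 1 vanishes.\<close>

lemma sum_add_char:
  assumes "k > 0"
  shows "(\<Sum>a = 0..k - 1. add_char k (a * m)) = (if k dvd m then of_int k else 0)"
proof -
  have "{0..k - 1} = int ` {..<nat k}"
    using assms by (auto simp: image_iff intro!: bexI[of _ "nat _"])
  then have "(\<Sum>a = 0..k - 1. add_char k (a * m)) = (\<Sum>j<nat k. add_char k m ^ j)"
    by (simp add: sum.reindex add_char_power)
  also have "\<dots> = (if k dvd m then of_int k else 0)"
  proof (cases "k dvd m")
    case True
    then show ?thesis using assms add_char_eq_1_iff[of k m] by simp
  next
    case False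
    have "add_char k m ^ nat k = 1"
      using assms add_char_eq_1_iff[of k "k * m"] by (simp add: add_char_power)
    then show ?thesis
      using False assms add_char_eq_1_iff[of k m] by (simp add: geometric_sum)
  qed
  finally show ?thesis .
qed

lemma finite_cube: "finite (cube k n)"
  by (simp add: cube_def finite_PiE)

text \<open>Entries lie in \<open>{0..k - 1}\<close>, a complete set of residues, so congruent
  entries are equal; off \<open>{1..n}\<close> extensionality fixes both vectors.\<close>

lemma cube_eqI:
  assumes "g \<in> cube k n" "h \<in> cube k n" "\<And>r. r \<in> {1..n} \<Longrightarrow> k dvd g r - h r"
  shows "g = h"
proof (rule PiE_ext)
  fix r assume r: "r \<in> {1..n}"
  then have "g r \<in> {0..k - 1}" "h r \<in> {0..k - 1}"
    using assms(1,2) by (auto simp: cube_def PiE_iff)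
  moreover have "g r mod k = h r mod k"
    using assms(3)[OF r] by (simp add: mod_eq_dvd_iff)
  ultimately show "g r = h r" by simp
qed (use assms in \<open>auto simp: cube_def\<close>)

text \<open>Orthogonality of the characters \<open>x\<close> ->
  \<open>add_char k (t * scalar_product n x g)\<close>. Coprimality of \<open>t\<close> and
  \<open>k\<close> lets \<open>t\<close> be cancelled in the divisibility conditions, so distinct
  \<open>g\<close> give distinct characters.\<close>

lemma sum_cube_add_char:
  assumes "k > 0" "coprime t k" "g \<in> cube k n" "h \<in> cube k n"
  shows "(\<Sum>x\<in>cube k n. add_char k (t * scalar_product n x g - t * scalar_product n x h))
    = (if g = h then of_int k ^ n else 0)"
proof -
  have "(\<Sum>x\<in>cube k n. add_char k (t * scalar_product n x g - t * scalar_product n x h))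
      = (\<Sum>x\<in>cube k n. \<Prod>r = 1..n. add_char k (x r * (t * (g r - h r))))"
    by (simp add: scalar_product_def sum_distrib_left add_char_sum algebra_simps
        flip: sum_subtractf)
  \<comment> \<open>The coordinates of \<open>x\<close> range independently over
    \<open>{0..k - 1}\<close>, so the sum over the cube factors into one complete character sum per
    coordinate.\<close>
  also have "\<dots> = (\<Prod>r = 1..n. \<Sum>a = 0..k - 1. add_char k (a * (t * (g r - h r))))"
    unfolding cube_def by (rule prod_sum_PiE[symmetric]) auto
  also have "\<dots> = (\<Prod>r = 1..n. if k dvd g r - h r then of_int k else 0)"
    using assms by (simp add: sum_add_char coprime_dvd_mult_right_iff coprime_commute)
  also have "\<dots> = (if g = h then of_int k ^ n else 0)"
  proof (cases "g = h")
    case False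
    then obtain r where "r \<in> {1..n}" "\<not> k dvd g r - h r"
      using cube_eqI assms(3,4) by blast
    then show ?thesis
      using False by (auto intro!: prod_zero bexI[of _ r])
  qed simp
  finally show ?thesis .
qed

text \<open>Expand each squared modulus as z times its conjugate and sum over the cube first: only
  the diagonal terms \<open>g = h\<close> survive, each contributing k^n.\<close>

lemma parseval_cube:
  assumes "k > 0" "coprime t k" "F \<subseteq> cube k n"
  shows "(\<Sum>x\<in>cube k n. (cmod (\<Sum>g\<in>F. add_char k (t * scalar_product n x g)))\<^sup>2)
    = real_of_int k ^ n * real (card F)"
proof -
  have fin: "finite F" using assms(3) finite_cube finite_subset by blast
  have "complex_of_real (\<Sum>x\<in>cube k n. (cmod (\<Sum>g\<in>F. add_char k (t * scalar_product n x g)))\<^sup>2)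
      = (\<Sum>x\<in>cube k n. \<Sum>g\<in>F. \<Sum>h\<in>F.
          add_char k (t * scalar_product n x g - t * scalar_product n x h))"
    unfolding of_real_sum complex_norm_square cnj_sum sum_product cnj_add_char diff_conv_add_uminus
      add_char_add ..
  also have "\<dots> = (\<Sum>g\<in>F. \<Sum>h\<in>F. \<Sum>x\<in>cube k n.
      add_char k (t * scalar_product n x g - t * scalar_product n x h))"
    by (subst sum.swap, rule sum.cong[OF refl], rule sum.swap)
  also have "\<dots> = (\<Sum>g\<in>F. \<Sum>h\<in>F. if g = h then of_int k ^ n else 0)"
    using assms by (intro sum.cong refl sum_cube_add_char) auto
  also have "\<dots> = complex_of_real (real_of_int k ^ n * real (card F))"
    using fin by simp
  finally show ?thesis by (simp only: of_real_eq_iff)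
qed

lemma norm_char_sum_le:
  assumes "k > 0" "coprime t k" "F \<subseteq> cube k n"
  shows "cmod (char_sum k n F t) \<le> real_of_int k powr (real n / 2) * real (card F)"
proof (rule power2_le_imp_le)
  let ?s = "\<lambda>x. cmod (\<Sum>g\<in>F. add_char k (t * scalar_product n x g))"
  have "cmod (char_sum k n F t) \<le> (\<Sum>f\<in>F. ?s f)"
    unfolding char_sum_def by (rule norm_sum)
  then have "(cmod (char_sum k n F t))\<^sup>2 \<le> (\<Sum>f\<in>F. ?s f)\<^sup>2"
    by (intro power_mono) auto
  also have "\<dots> \<le> (\<Sum>f\<in>F. (?s f)\<^sup>2) * card F"
    by (rule sum_squared_le_sum_of_squares)
  \<comment> \<open>The added terms are squares, hence nonnegative, and over the full cube Parseval
    evaluates the sum exactly.\<close>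
  also have "\<dots> \<le> (\<Sum>f\<in>cube k n. (?s f)\<^sup>2) * card F"
    using assms(3) by (intro mult_right_mono sum_mono2 finite_cube) auto
  also have "\<dots> = real_of_int k ^ n * (real (card F))\<^sup>2"
    using parseval_cube[OF assms] by (simp add: power2_eq_square)
  also have "\<dots> = (real_of_int k powr (real n / 2) * real (card F))\<^sup>2"
    using assms(1) by (simp add: power_mult_distrib powr_half_sqrt_powr powr_realpow)
  finally show "(cmod (char_sum k n F t))\<^sup>2 \<le> (real_of_int k powr (real n / 2) * real (card F))\<^sup>2" .
qed simp

lemma char_sum_town_family:
  assumes "k > 0" "town_family k n F"
  shows "char_sum k n F 1 = (of_nat (card F))\<^sup>2"
proof -
  have "add_char k (1 * scalar_product n f g) = 1" if "f \<in> F" "g \<in> F" for f g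
    using assms that by (simp add: town_family_def add_char_eq_1_iff cong_0_iff)
  then show ?thesis by (simp add: char_sum_def power2_eq_square)
qed

text \<open>Summing over \<open>t\<close> inside, an orthogonal pair contributes k - 1 and any other
  pair -1, that is, (k - 1) - k.\<close>

lemma sum_char_sum:
  assumes "k > 0" "finite F"
  shows "(\<Sum>t = 1..k - 1. char_sum k n F t) = of_int (k - 1) * (of_nat (card F))\<^sup>2
    - of_int k * of_nat (card {(f, g) \<in> F \<times> F. \<not> [scalar_product n f g = 0] (mod k)})"
proof -
  let ?N = "{(f, g) \<in> F \<times> F. \<not> [scalar_product n f g = 0] (mod k)}"
  have inner: "(\<Sum>t = 1..k - 1. add_char k (t * m)) = of_int (k - 1) - (if k dvd m then 0 else of_int k)"
    for m
  proof -
    \<comment> \<open>The complete sum over \<open>{0..k - 1}\<close> is known; removing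
      \<open>t = 0\<close> subtracts 1.\<close>
    have "{0..k - 1} = insert 0 {1..k - 1}" using assms(1) by auto
    then show ?thesis using sum_add_char[OF assms(1), of m] by (auto simp: algebra_simps)
  qed
  have "(\<Sum>t = 1..k - 1. char_sum k n F t)
      = (\<Sum>p\<in>F \<times> F. \<Sum>t = 1..k - 1. add_char k (t * (case p of (f, g) \<Rightarrow> scalar_product n f g)))"
    unfolding char_sum_def sum.cartesian_product[of _ F F]
    by (subst sum.swap) (simp add: case_prod_unfold)
  also have "\<dots> = of_int (k - 1) * of_nat (card (F \<times> F))
      - (\<Sum>p\<in>F \<times> F. if p \<in> ?N then of_int k else 0)"
    unfolding inner sum_subtractf
    by (intro arg_cong2[of _ _ _ _ minus] sum.cong) (auto simp: cong_0_iff)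
  also have "(\<Sum>p\<in>F \<times> F. if p \<in> ?N then of_int k else 0) = of_int k * (of_nat (card ?N) :: complex)"
  proof -
    have "F \<times> F \<inter> ?N = ?N" by auto
    then show ?thesis
      using sum.inter_restrict[of "F \<times> F" "\<lambda>_. complex_of_int k" ?N] assms(2)
      by (simp add: mult.commute)
  qed
  finally show ?thesis by (simp add: card_cartesian_product power2_eq_square)
qed

lemma town_family_card_le:
  assumes "k > 0" "town_family k n F"
  shows "real (card F) \<le> real_of_int k powr (real n / 2)"
proof -
  have "cmod (char_sum k n F 1) \<le> real_of_int k powr (real n / 2) * real (card F)"
    using assms by (intro norm_char_sum_le) (auto simp: town_family_def)
  then have "real (card F) * real (card F) \<le> real_of_int k powr (real n / 2) * real (card F)"
    using assms by (simp add: char_sum_town_family norm_mult power2_eq_square)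
  \<comment> \<open>Cancel one factor \<open>card F\<close>; for empty \<open>F\<close> the bound
    only says that the power of \<open>k\<close> is nonnegative.\<close>
  then show ?thesis
    by (cases "card F = 0") simp_all
qed

lemma almost_town_family_card_le:
  fixes \<epsilon> :: real
  assumes "prime k" "F \<subseteq> cube k n" "\<epsilon> < (real_of_int k - 1) / real_of_int k"
    and few: "real (card {(f, g) \<in> F \<times> F. \<not> [scalar_product n f g = 0] (mod k)})
      \<le> \<epsilon> * (real (card F))\<^sup>2"
  shows "real (card F) \<le> real_of_int k powr (real n / 2)
    / (1 - real_of_int k / (real_of_int k - 1) * \<epsilon>)"
proof -
  let ?N = "card {(f, g) \<in> F \<times> F. \<not> [scalar_product n f g = 0] (mod k)}"
  let ?c = "real (card F)" and ?k = "real_of_int k"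
  define P where "P = ?k powr (real n / 2)"
  \<comment> \<open>Chosen so that (k - 1) c^2 - k \<epsilon> c^2 = (k - 1) d c^2, where c is the
    size of \<open>F\<close>; the upper bound on \<epsilon> says precisely that
    \<open>d > 0\<close>, which permits the final division.\<close>
  define d where "d = 1 - ?k / (?k - 1) * \<epsilon>"
  have k: "k > 1" using assms(1) by (simp add: prime_gt_1_int)
  have fin: "finite F" using assms(2) finite_cube finite_subset by blast
  have "d > 0" using assms(3) k by (simp add: d_def field_simps)
  \<comment> \<open>The sum of the \<open>char_sum\<close> values is real, so it is at most its
    modulus, to which the triangle inequality applies.\<close>
  have "(?k - 1) * ?c\<^sup>2 - ?k * ?N \<le> cmod (complex_of_real ((?k - 1) * ?c\<^sup>2 - ?k * ?N))"
    by (simp only: norm_of_real abs_ge_self)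
  also have "complex_of_real ((?k - 1) * ?c\<^sup>2 - ?k * ?N) = (\<Sum>t = 1..k - 1. char_sum k n F t)"
    using k fin by (simp add: sum_char_sum)
  also have "cmod (\<Sum>t = 1..k - 1. char_sum k n F t) \<le> (\<Sum>t = 1..k - 1. P * ?c)"
  proof (rule sum_norm_le)
    fix t assume t: "t \<in> {1..k - 1}"
    \<comment> \<open>Primality enters here: every \<open>t\<close> strictly between 0 and
      \<open>k\<close> is coprime to \<open>k\<close>, so the norm bound holds for all k - 1
      summands.\<close>
    then have "\<not> k dvd t" by (auto dest: zdvd_imp_le)
    then have "coprime t k" using assms(1) by (simp add: prime_imp_coprime coprime_commute)
    then show "cmod (char_sum k n F t) \<le> P * ?c"
      using norm_char_sum_le k assms(2) by (simp add: P_def)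
  qed
  also have "\<dots> = (?k - 1) * (P * ?c)" using k by simp
  finally have "(?k - 1) * ?c\<^sup>2 - ?k * (\<epsilon> * ?c\<^sup>2) \<le> (?k - 1) * (P * ?c)"
    using mult_left_mono[OF few, of ?k] k by linarith
  moreover have "(?k - 1) * ?c\<^sup>2 - ?k * (\<epsilon> * ?c\<^sup>2) = (?k - 1) * (d * ?c * ?c)"
    using k by (simp add: d_def field_simps power2_eq_square)
  ultimately have "d * ?c * ?c \<le> P * ?c" using k by simp
  then have "d * ?c \<le> P"
    by (cases "card F = 0") (simp_all add: P_def)
  then show ?thesis
    using \<open>d > 0\<close> unfolding P_def[symmetric] d_def[symmetric] by (simp add: field_simps)
qed

theorem theorem3:
  fixes k :: int and n :: nat
  assumes "k \<ge> 2" and "n \<ge> 1"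
  shows "(\<forall>F. town_family k n F \<longrightarrow> real (card F) \<le> real_of_int k powr (real n / 2)) \<and>
    (prime k \<longrightarrow>
      (\<forall>F (\<epsilon>::real). F \<subseteq> cube k n \<longrightarrow> 0 \<le> \<epsilon> \<longrightarrow>
         \<epsilon> < (real_of_int k - 1) / real_of_int k \<longrightarrow>
         real (card {(f, g) \<in> F \<times> F. \<not> [scalar_product n f g = 0] (mod k)})
           \<le> \<epsilon> * (real (card F))\<^sup>2 \<longrightarrow>
         real (card F) \<le> real_of_int k powr (real n / 2)
           / (1 - real_of_int k / (real_of_int k - 1) * \<epsilon>)))"
  using assms town_family_card_le almost_town_family_card_le by auto

end
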